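(* Let $n\geq 2$ be an integer and let $n=p_1^{e_1}p_2^{e_2}\cdots p_k^{e_k}$ be its prime factorization, where $p_1,\ldots,p_k$ are distinct primes and $e_1,e_2,\ldots,e_k\in\mathbb Z^+$. Then $\iota(Q_{4n})=k+1$.
   Context: $Q_{4n}=\langle x,y : x^{2n}=1,\ x^n=y^2,\ x^{-1}=y^{-1}xy\rangle$ denotes the dicyclic group of order $4n$, where $n\geq 2$. The Frattini subgroup $\Phi(G)$ of a finite group $G$ is the intersection of all maximal subgroups of $G$. For a nontrivial finite group $G$, the intersection number $\iota(G)$ is the minimum number of maximal subgroups of $G$ whose intersection equals $\Phi(G)$. *)

theory Defs
  imports "HOL-Algebra.Coset" "HOL-Computational_Algebra.Primes"
begin

section \<open>Groups given by generators and relations\<close>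

datatype 'g letter = Gen 'g | Inv 'g

text \<open>
  The least congruence on the monoid of words in the letters \<open>g\<close>, \<open>g\<inverse>\<close> that contains free
  cancellation and the pairs \<open>(u, v) \<in> R\<close>, each read as a relation \<open>u = v\<close>.  Every element of
  the type \<open>'g\<close> is a generator.
\<close>

inductive pres_eq :: "('g letter list \<times> 'g letter list) set \<Rightarrow> 'g letter list \<Rightarrow> 'g letter list \<Rightarrow> bool"
  for R where
  pres_refl: "pres_eq R u u"
| pres_sym: "pres_eq R u v \<Longrightarrow> pres_eq R v u"
| pres_trans: "pres_eq R u v \<Longrightarrow> pres_eq R v w \<Longrightarrow> pres_eq R u w"
| pres_append: "pres_eq R u u' \<Longrightarrow> pres_eq R v v' \<Longrightarrow> pres_eq R (u @ v) (u' @ v')"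
| pres_Gen_Inv: "pres_eq R [Gen g, Inv g] []"
| pres_Inv_Gen: "pres_eq R [Inv g, Gen g] []"
| pres_rel: "(u, v) \<in> R \<Longrightarrow> pres_eq R u v"

definition pres_class :: "('g letter list \<times> 'g letter list) set \<Rightarrow> 'g letter list \<Rightarrow> 'g letter list set"
  where "pres_class R u = {v. pres_eq R u v}"

definition presented_group ::
  "('g letter list \<times> 'g letter list) set \<Rightarrow> 'g letter list set monoid" where
  "presented_group R =
     \<lparr>carrier = range (pres_class R),
      monoid.mult = (\<lambda>A B. {w. \<exists>u\<in>A. \<exists>v\<in>B. pres_eq R (u @ v) w}),
      one = pres_class R []\<rparr>"

lemma pres_class_eq_iff: "pres_class R u = pres_class R v \<longleftrightarrow> pres_eq R u v"
  unfolding pres_class_def using pres_refl pres_sym pres_trans by blast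

lemma presented_group_mult:
  "pres_class R u \<otimes>\<^bsub>presented_group R\<^esub> pres_class R v = pres_class R (u @ v)"
  unfolding presented_group_def pres_class_def
  by (auto intro: pres_refl pres_trans pres_append)

lemma group_presented_group: "group (presented_group R)"
proof (rule groupI)
  let ?G = "presented_group R"
  have carr: "carrier ?G = range (pres_class R)" and one: "\<one>\<^bsub>?G\<^esub> = pres_class R []"
    by (simp_all add: presented_group_def)
  show "x \<otimes>\<^bsub>?G\<^esub> y \<in> carrier ?G" if "x \<in> carrier ?G" "y \<in> carrier ?G" for x y
    using that by (auto simp: carr presented_group_mult)
  show "\<one>\<^bsub>?G\<^esub> \<in> carrier ?G"
    by (simp add: carr one)
  show "(x \<otimes>\<^bsub>?G\<^esub> y) \<otimes>\<^bsub>?G\<^esub> z = x \<otimes>\<^bsub>?G\<^esub> (y \<otimes>\<^bsub>?G\<^esub> z)"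
    if "x \<in> carrier ?G" "y \<in> carrier ?G" "z \<in> carrier ?G" for x y z
    using that by (auto simp: carr presented_group_mult)
  show "\<one>\<^bsub>?G\<^esub> \<otimes>\<^bsub>?G\<^esub> x = x" if "x \<in> carrier ?G" for x
    using that by (auto simp: carr one presented_group_mult)
  have "\<exists>v. pres_eq R (v @ u) []" for u
  proof (induction u)
    case Nil
    show ?case using pres_refl[of R "[]"] by (intro exI[of _ "[]"]) simp
  next
    case (Cons a u)
    then obtain v where v: "pres_eq R (v @ u) []" by blast
    obtain b where b: "pres_eq R [b, a] []"
      by (cases a) (auto intro: pres_Inv_Gen pres_Gen_Inv)
    have "pres_eq R (v @ ([b, a] @ u)) (v @ ([] @ u))"
      by (intro pres_append pres_refl b)
    then have "pres_eq R ((v @ [b]) @ a # u) []"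
      using v pres_trans by fastforce
    then show ?case by blast
  qed
  then show "\<exists>y\<in>carrier ?G. y \<otimes>\<^bsub>?G\<^esub> x = \<one>\<^bsub>?G\<^esub>" if "x \<in> carrier ?G" for x
    using that by (fastforce simp: carr one presented_group_mult pres_class_eq_iff)
qed

section \<open>The dicyclic group of order $4n$\<close>

datatype dic_gen = X | Y

definition dicyclic_rels :: "nat \<Rightarrow> (dic_gen letter list \<times> dic_gen letter list) set" where
  "dicyclic_rels n =
     {(replicate (2 * n) (Gen X), []),
      (replicate n (Gen X), [Gen Y, Gen Y]),
      ([Inv X], [Inv Y, Gen X, Gen Y])}"

definition dicyclic :: "nat \<Rightarrow> dic_gen letter list set monoid" where
  "dicyclic n = presented_group (dicyclic_rels n)"

section \<open>Frattini subgroup and intersection number\<close>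

definition maximal_subgroup :: "'a set \<Rightarrow> ('a, 'b) monoid_scheme \<Rightarrow> bool" where
  "maximal_subgroup M G \<longleftrightarrow>
     subgroup M G \<and> M \<noteq> carrier G \<and>
     (\<forall>H. subgroup H G \<longrightarrow> M \<subseteq> H \<longrightarrow> H = M \<or> H = carrier G)"

text \<open>
  The empty intersection of subgroups is the whole group, hence the intersections with
  \<open>carrier G\<close> below; for nonempty families they have no effect.
\<close>

definition frattini :: "('a, 'b) monoid_scheme \<Rightarrow> 'a set" where
  "frattini G = carrier G \<inter> \<Inter>{M. maximal_subgroup M G}"

text \<open>
  Meaningful for finite \<open>G\<close>, where the family of all maximal subgroups is a witness.
\<close>

definition intersection_number :: "('a, 'b) monoid_scheme \<Rightarrow> nat" where
  "intersection_number G =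
     (LEAST m. \<exists>\<M>. finite \<M> \<and> card \<M> = m \<and> (\<forall>M\<in>\<M>. maximal_subgroup M G) \<and>
                   carrier G \<inter> \<Inter>\<M> = frattini G)"

end

theory Submission
  imports Defs "HOL-Number_Theory.Cong"
begin

text \<open>
  Every element of \<open>Q\<^bsub>4n\<^esub>\<close> is \<open>x\<^sup>a y\<^sup>s\<close> with \<open>a\<close> taken modulo \<open>2n\<close> and \<open>s \<in> {0, 1}\<close>.  The maximal
  subgroups are \<open>\<langle>x\<rangle>\<close> and \<open>\<langle>x\<^sup>p, x\<^sup>r y\<rangle>\<close> for the primes \<open>p\<close> dividing \<open>n\<close> and the residues \<open>r\<close>
  modulo \<open>p\<close>.  The group \<open>\<langle>x\<rangle>\<close> together with \<open>\<langle>x\<^sup>p, y\<rangle>\<close> for each \<open>p\<close> cuts out the Frattini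
  subgroup.  Conversely, a family that does so must contain some \<open>\<langle>x\<^sup>p, x\<^sup>r y\<rangle>\<close> for each \<open>p\<close>; if it
  consisted of exactly one of them for each \<open>p\<close>, the Chinese remainder theorem would provide an
  element \<open>x\<^sup>a y\<close> in the intersection, although \<open>\<langle>x\<rangle>\<close> contains no such element.
\<close>

section \<open>Maximal subgroups in coordinates\<close>

text \<open>\<open>E a s\<close> stands for \<open>x\<^sup>a y\<^sup>s\<close>.\<close>

locale dicyclic_coordinates = group G for G (structure) +
  fixes n :: nat and E :: "int \<Rightarrow> bool \<Rightarrow> 'a"
  assumes n_pos: "n > 0"
    and carrier_E: "carrier G = {E a s |a s. True}"
    and E_eq_iff: "E a s = E b t \<longleftrightarrow> 2 * int n dvd a - b \<and> s = t"
    and E_mult: "E a s \<otimes> E b t =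
      E (a + (if s then - b else b) + (if s \<and> t then int n else 0)) (s \<noteq> t)"
begin

lemma E_closed [simp, intro]: "E a s \<in> carrier G"
  by (auto simp: carrier_E)

lemma one_E: "\<one> = E 0 False"
proof -
  have "E 0 False \<otimes> E 0 False = E 0 False"
    by (simp add: E_mult)
  then show ?thesis
    by (metis E_closed r_cancel_one)
qed

lemma inv_E: "inv (E a s) = E (if s then a + int n else - a) s"
  by (intro inv_equality) (auto simp: E_mult one_E E_eq_iff)

definition rotations :: "'a set" where
  "rotations = {E a False |a. True}"

text \<open>For \<open>p\<close> dividing \<open>n\<close> this is the subgroup generated by x^p and
  x^r y, encoded by a congruence so that membership becomes divisibility.\<close>

definition extended :: "nat \<Rightarrow> int \<Rightarrow> 'a set" where
  "extended p r = {E a s |a s. int p dvd a - (if s then r else 0)}"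

lemma E_in_rotations [simp]: "E a s \<in> rotations \<longleftrightarrow> \<not> s"
  by (auto simp: rotations_def E_eq_iff intro: exI[of _ a])

text \<open>An exponent is determined only modulo \<open>2 * n\<close>; since \<open>p\<close>
  divides \<open>n\<close>, its residue modulo \<open>p\<close> does not depend on the
  representative.\<close>

lemma E_in_extended:
  assumes "p dvd n"
  shows "E a s \<in> extended p r \<longleftrightarrow> int p dvd a - (if s then r else 0)"
proof
  assume "E a s \<in> extended p r"
  then obtain b where b: "2 * int n dvd a - b" "int p dvd b - (if s then r else 0)"
    unfolding extended_def by (auto simp: E_eq_iff)
  have "int p dvd a - b"
    using assms b(1) by (meson dvd_trans dvd_mult of_nat_dvd_iff)
  then have "int p dvd (a - b) + (b - (if s then r else 0))"
    using b(2) dvd_add by blast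
  then show "int p dvd a - (if s then r else 0)"
    by simp
next
  assume "int p dvd a - (if s then r else 0)"
  then show "E a s \<in> extended p r"
    unfolding extended_def by blast
qed

lemma subset_by_E:
  assumes "A \<subseteq> carrier G" "\<And>a s. E a s \<in> A \<Longrightarrow> E a s \<in> B"
  shows "A \<subseteq> B"
proof
  fix z assume "z \<in> A"
  then show "z \<in> B"
    using assms unfolding carrier_E by blast
qed

lemma subgroup_by_E:
  assumes "H \<subseteq> carrier G" "E 0 False \<in> H"
    and "\<And>a s. E a s \<in> H \<Longrightarrow> inv (E a s) \<in> H"
    and "\<And>a s b t. E a s \<in> H \<Longrightarrow> E b t \<in> H \<Longrightarrow> E a s \<otimes> E b t \<in> H"
  shows "subgroup H G"
proof (rule subgroupI)
  show "inv z \<in> H" if "z \<in> H" for z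
    using that assms(1,3) unfolding carrier_E by blast
  show "z \<otimes> w \<in> H" if "z \<in> H" "w \<in> H" for z w
    using that assms(1,4) unfolding carrier_E by blast
qed (use assms in auto)

lemma rotations_subset: "rotations \<subseteq> carrier G"
  by (auto simp: rotations_def)

lemma reflection_outside_rotations:
  assumes "H \<subseteq> carrier G" "\<not> H \<subseteq> rotations"
  obtains r where "E r True \<in> H"
proof -
  obtain a s where "E a s \<in> H" "E a s \<notin> rotations"
    using assms subset_by_E by blast
  then show thesis
    using that by auto
qed

lemma extended_subset: "extended p r \<subseteq> carrier G"
  by (auto simp: extended_def)

lemma subgroup_rotations: "subgroup rotations G"
  by (rule subgroup_by_E) (auto simp: rotations_subset inv_E E_mult)

lemma subgroup_extended:
  assumes "p dvd n"
  shows "subgroup (extended p r) G"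
proof (rule subgroup_by_E[OF extended_subset])
  have pn: "int p dvd int n"
    using assms by simp
  show "E 0 False \<in> extended p r"
    using assms by (simp add: E_in_extended)
  show "inv (E a s) \<in> extended p r" if "E a s \<in> extended p r" for a s
  proof -
    have "int p dvd a - r + int n" if "int p dvd a - r"
      using that pn by (rule dvd_add)
    then show ?thesis
      using that assms by (auto simp: E_in_extended inv_E algebra_simps)
  qed
  show "E a s \<otimes> E b t \<in> extended p r"
    if "E a s \<in> extended p r" "E b t \<in> extended p r" for a s b t
  proof -
    from that assms have "int p dvd a - (if s then r else 0)" "int p dvd b - (if t then r else 0)"
      by (simp_all add: E_in_extended)
    then obtain u v where "a = int p * u + (if s then r else 0)"
      "b = int p * v + (if t then r else 0)"
      by (metis dvd_def diff_add_cancel)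
    \<comment> \<open>When \<open>s\<close> and \<open>t\<close> both hold, the product has exponent
      \<open>a - b + n\<close>: the two residues \<open>r\<close> cancel and the summand
      \<open>n\<close> is a multiple of \<open>p\<close>.\<close>
    moreover obtain w where "int n = int p * w"
      using pn by blast
    ultimately show ?thesis
      using assms
      by (cases s; cases t) (auto simp: E_in_extended E_mult)
  qed
qed

section \<open>Exponents of x inside a subgroup\<close>

lemma exponent_add:
  assumes "subgroup H G" "E a False \<in> H" "E b False \<in> H"
  shows "E (a + b) False \<in> H"
  using subgroup.m_closed[OF assms] by (simp add: E_mult)

lemma exponent_minus:
  assumes "subgroup H G" "E a False \<in> H"
  shows "E (- a) False \<in> H"
  using subgroup.m_inv_closed[OF assms] by (simp add: inv_E)

lemma exponent_mult:
  assumes H: "subgroup H G" "E a False \<in> H"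
  shows "E (c * a) False \<in> H"
proof -
  have nat: "E (int m * a) False \<in> H" for m
  proof (induction m)
    case 0
    then show ?case
      using subgroup.one_closed[OF H(1)] by (simp add: one_E)
  next
    case (Suc m)
    then show ?case
      using exponent_add[OF H(1) H(2) Suc] by (simp add: algebra_simps)
  qed
  show ?thesis
    using nat[of "nat c"] exponent_minus[OF H(1) nat[of "nat (- c)"]]
    by (cases "c \<ge> 0") auto
qed

text \<open>The inverse of x^b y is x^(b+n) y, and the two shifts by \<open>n\<close> cancel in the
  product.\<close>

lemma exponent_diff:
  assumes H: "subgroup H G" "E a True \<in> H" "E b True \<in> H"
  shows "E (a - b) False \<in> H"
  using subgroup.m_closed[OF H(1,2) subgroup.m_inv_closed[OF H(1,3)]]
  by (simp add: inv_E E_mult)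

text \<open>The powers of x come from \<open>E 1 False\<close>, and x^(a-r) times x^r y is x^a y.
  Proving a subgroup to be everything thus reduces to finding x and one element outside
  \<open>rotations\<close>.\<close>

lemma subgroup_eq_carrier:
  assumes H: "subgroup H G" "E 1 False \<in> H" "E r True \<in> H"
  shows "H = carrier G"
proof (rule antisym[OF subgroup.subset[OF H(1)] subset_by_E])
  fix a s
  have "E b False \<in> H" for b
    using exponent_mult[OF H(1,2), of b] by simp
  then have "E a False \<in> H" "E (a - r) False \<otimes> E r True \<in> H"
    using subgroup.m_closed[OF H(1)] H(3) by blast+
  then show "E a s \<in> H"
    by (cases s) (simp_all add: E_mult)
qed simp

section \<open>Maximality and classification of the maximal subgroups\<close>

lemma maximal_rotations: "maximal_subgroup rotations G"
  unfolding maximal_subgroup_def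
proof (intro conjI allI impI)
  have "E 0 True \<notin> rotations"
    by simp
  then show "rotations \<noteq> carrier G"
    using E_closed by blast
  fix H assume H: "subgroup H G" "rotations \<subseteq> H"
  show "H = rotations \<or> H = carrier G"
  proof (cases "H \<subseteq> rotations")
    case False
    then obtain r where "E r True \<in> H"
      using reflection_outside_rotations subgroup.subset[OF H(1)] by blast
    moreover have "E 1 False \<in> H"
      using H(2) by auto
    ultimately show ?thesis
      using subgroup_eq_carrier H(1) by blast
  qed (use H in auto)
qed (rule subgroup_rotations)

lemma extended_neq_carrier:
  assumes "prime p" "p dvd n"
  shows "extended p r \<noteq> carrier G"
proof -
  have "E 1 False \<notin> extended p r"
    using assms by (auto simp: E_in_extended)
  then show ?thesis
    using E_closed by blast
qed

text \<open>A strictly larger \<open>H\<close> contains some x^b with \<open>p\<close> not dividing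
  \<open>b\<close>; together with x^p this yields x by Bezout.\<close>

lemma maximal_extended:
  assumes p: "prime p" "p dvd n"
  shows "maximal_subgroup (extended p r) G"
  unfolding maximal_subgroup_def
proof (intro conjI allI impI)
  fix H assume H: "subgroup H G" "extended p r \<subseteq> H"
  have r: "E r True \<in> H" and p': "E (int p) False \<in> H"
    using H(2) p(2) by (auto simp: E_in_extended)
  show "H = extended p r \<or> H = carrier G"
  proof (cases "H \<subseteq> extended p r")
    case False
    then obtain a s where as: "E a s \<in> H" "E a s \<notin> extended p r"
      using subset_by_E[OF subgroup.subset[OF H(1)], of "extended p r"] by blast
    \<comment> \<open>Dividing by x^r y if necessary moves the extra element into
      \<open>rotations\<close>; it still avoids \<open>extended p r\<close>, because x^r y lies in
      that subgroup.\<close>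
    define b where "b = a - (if s then r else 0)"
    have b: "E b False \<in> H"
      using as(1) exponent_diff[OF H(1) _ r] by (auto simp: b_def)
    have "\<not> int p dvd b"
      using as(2) p(2) by (simp add: E_in_extended b_def)
    then have "coprime (int p) b"
      using p(1) by (simp add: prime_imp_coprime)
    then obtain u v where "u * int p + v * b = 1"
      using bezout_int[of "int p" b] by auto
    then have "E 1 False \<in> H"
      using exponent_add[OF H(1) exponent_mult[OF H(1) p'] exponent_mult[OF H(1) b]] by metis
    then show ?thesis
      using subgroup_eq_carrier H(1) r by blast
  qed (use H in auto)
qed (use p subgroup_extended extended_neq_carrier in blast)+

text \<open>The exponents of the powers of x in \<open>H\<close> form a subgroup of the integers
  containing \<open>n\<close>. Its positive generator \<open>d\<close> is not 1, so any prime factor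
  of \<open>d\<close> divides them all.\<close>

lemma common_prime_of_exponents:
  assumes H: "subgroup H G" "E (int n) False \<in> H" "E 1 False \<notin> H"
  obtains p where "prime p" "p dvd n" "\<And>a. E a False \<in> H \<Longrightarrow> int p dvd a"
proof -
  \<comment> \<open>The minimum exists because \<open>n\<close> itself is a positive
    exponent.\<close>
  define d where "d = (LEAST m. m > 0 \<and> E (int m) False \<in> H)"
  have d: "d > 0" "E (int d) False \<in> H"
    using LeastI[of "\<lambda>m. m > 0 \<and> E (int m) False \<in> H" n] n_pos H(2) unfolding d_def by auto
  have d_dvd: "int d dvd a" if a: "E a False \<in> H" for a
  proof -
    have "a mod int d = a + (- (a div int d)) * int d"
      by (simp add: minus_div_mult_eq_mod)
    then have "E (a mod int d) False \<in> H"
      using exponent_add[OF H(1) a exponent_mult[OF H(1) d(2)]] by metis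
    moreover have "a mod int d \<ge> 0" "a mod int d < int d"
      using d(1) by simp_all
    ultimately have "\<not> nat (a mod int d) > 0"
      using not_less_Least[of "nat (a mod int d)" "\<lambda>m. m > 0 \<and> E (int m) False \<in> H"]
      by (auto simp: d_def[symmetric])
    then show ?thesis
      using \<open>a mod int d \<ge> 0\<close> by (simp add: dvd_eq_mod_eq_0)
  qed
  have "d \<noteq> 1"
    using d H(3) by auto
  then obtain p where p: "prime p" "p dvd d"
    using prime_factor_nat by blast
  show thesis
  proof
    show "p dvd n"
      using d_dvd[OF H(2)] p(2) by (meson dvd_trans of_nat_dvd_iff)
    show "int p dvd a" if "E a False \<in> H" for a
      using d_dvd[OF that] p(2) by (meson dvd_trans of_nat_dvd_iff)
  qed (fact p(1))
qed

text \<open>If \<open>H\<close> contains x^r y, a prime dividing all exponents of powers of x in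
  \<open>H\<close> also forces every x^a y in \<open>H\<close> to satisfy a = r modulo that prime.
  Hence \<open>H\<close> lies in a proper subgroup \<open>extended p r\<close>, and maximality gives
  equality.\<close>

lemma maximal_subgroup_cases:
  assumes "maximal_subgroup H G"
  obtains "H = rotations" | p r where "prime p" "p dvd n" "H = extended p r"
proof (cases "H \<subseteq> rotations")
  case True
  then show ?thesis
    using assms that(1) maximal_rotations unfolding maximal_subgroup_def by metis
next
  case False
  have H: "subgroup H G" "H \<noteq> carrier G"
    using assms by (auto simp: maximal_subgroup_def)
  obtain r where r: "E r True \<in> H"
    using reflection_outside_rotations[OF subgroup.subset[OF H(1)] False] by blast
  \<comment> \<open>This is the square of x^r y, whatever \<open>r\<close> is.\<close>
  have "E (int n) False \<in> H"
    using subgroup.m_closed[OF H(1) r r] by (simp add: E_mult)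
  moreover have "E 1 False \<notin> H"
    using subgroup_eq_carrier H r by blast
  ultimately obtain p where p: "prime p" "p dvd n" "\<And>a. E a False \<in> H \<Longrightarrow> int p dvd a"
    using common_prime_of_exponents H(1) by blast
  have "E a s \<in> extended p r" if "E a s \<in> H" for a s
    using that p(3) exponent_diff[OF H(1) _ r] p(2) by (cases s) (auto simp: E_in_extended)
  then have "H \<subseteq> extended p r"
    using subset_by_E[OF subgroup.subset[OF H(1)]] by blast
  then have "H = extended p r"
    using assms subgroup_extended[OF p(2)] extended_neq_carrier[OF p(1,2)]
    unfolding maximal_subgroup_def by metis
  then show ?thesis
    using that(2) p(1,2) by blast
qed

section \<open>The intersection number\<close>

text \<open>The element x^p separates the primes: it lies in \<open>extended p r\<close> for every
  \<open>r\<close>, but in \<open>extended q r\<close> only if \<open>q\<close> divides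
  \<open>p\<close>. The residues stay arbitrary because the lower bound has no control over
  them.\<close>

lemma inj_on_extended: "inj_on (\<lambda>p. extended p (r p)) (prime_factors n)"
proof (rule inj_onI)
  fix p q assume pq: "p \<in> prime_factors n" "q \<in> prime_factors n"
    and eq: "extended p (r p) = extended q (r q)"
  have "E (int p) False \<in> extended p (r p)"
    using pq(1) by (simp add: E_in_extended in_prime_factors_iff)
  then have "q dvd p"
    using pq(2) eq by (simp add: E_in_extended in_prime_factors_iff)
  then show "p = q"
    using pq by (metis in_prime_factors_imp_prime primes_dvd_imp_eq)
qed

text \<open>The upper bound. Membership in \<open>rotations\<close> removes y, and the subgroups
  \<open>extended p 0\<close> make the exponent divisible by every prime factor of
  \<open>n\<close>.\<close>

lemma frattini_witness:
  defines "\<M> \<equiv> insert rotations ((\<lambda>p. extended p 0) ` prime_factors n)"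
  shows "finite \<M>" "card \<M> = card (prime_factors n) + 1" "\<forall>M\<in>\<M>. maximal_subgroup M G"
    "carrier G \<inter> \<Inter>\<M> = frattini G"
proof -
  show "finite \<M>"
    by (simp add: \<M>_def)
  have "E 0 True \<in> extended p 0" if "p \<in> prime_factors n" for p
    using that by (simp add: E_in_extended in_prime_factors_iff)
  moreover have "E 0 True \<notin> rotations"
    by simp
  ultimately have "rotations \<notin> (\<lambda>p. extended p 0) ` prime_factors n"
    by blast
  then show "card \<M> = card (prime_factors n) + 1"
    using card_image[OF inj_on_extended[of "\<lambda>_. 0"]] by (simp add: \<M>_def)
  show max: "\<forall>M\<in>\<M>. maximal_subgroup M G"
    by (auto simp: \<M>_def maximal_rotations maximal_extended in_prime_factors_iff)
  show "carrier G \<inter> \<Inter>\<M> = frattini G"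
  proof
    show "frattini G \<subseteq> carrier G \<inter> \<Inter>\<M>"
      using max by (auto simp: frattini_def)
    show "carrier G \<inter> \<Inter>\<M> \<subseteq> frattini G"
    proof (rule subset_by_E)
      fix a s assume as: "E a s \<in> carrier G \<inter> \<Inter>\<M>"
      then have s: "\<not> s"
        by (auto simp: \<M>_def)
      have a: "int p dvd a" if "prime p" "p dvd n" for p
      proof -
        have "p \<in> prime_factors n"
          using that n_pos by (simp add: in_prime_factors_iff)
        then have "E a s \<in> extended p 0"
          using as by (auto simp: \<M>_def)
        then show ?thesis
          using that(2) by (simp add: E_in_extended)
      qed
      \<comment> \<open>Since \<open>s\<close> is false, the residue \<open>r\<close> of
        \<open>extended p r\<close> does not enter, so divisibility by \<open>p\<close>
        suffices.\<close>
      have "E a s \<in> M" if "maximal_subgroup M G" for M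
        using that by (cases rule: maximal_subgroup_cases) (auto simp: s a E_in_extended)
      then show "E a s \<in> frattini G"
        by (simp add: frattini_def)
    qed simp
  qed
qed

text \<open>Let \<open>m\<close> be the product of the other prime factors of \<open>n\<close>. Then
  x^m lies in \<open>rotations\<close> and in every \<open>extended q r\<close> with q different
  from \<open>p\<close>, but not in \<open>extended p 0\<close>, so a family missing
  \<open>p\<close> intersects in too much.\<close>

lemma frattini_family_meets_prime:
  assumes \<M>: "\<forall>M\<in>\<M>. maximal_subgroup M G" "carrier G \<inter> \<Inter>\<M> = frattini G"
    and p: "p \<in> prime_factors n"
  shows "\<exists>r. extended p r \<in> \<M>"
proof (rule ccontr)
  assume no: "\<nexists>r. extended p r \<in> \<M>"
  define m where "m = \<Prod>(prime_factors n - {p})"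
  have q_dvd: "q dvd m" if "prime q" "q dvd n" "q \<noteq> p" for q
    using that n_pos unfolding m_def by (intro dvd_prodI) (auto simp: in_prime_factors_iff)
  have "\<not> p dvd m"
  proof
    assume "p dvd m"
    moreover have "prime p"
      using p by (rule in_prime_factors_imp_prime)
    ultimately obtain q where q: "q \<in> prime_factors n - {p}" "p dvd q"
      unfolding m_def by (meson finite_Diff finite_set_mset prime_dvd_prod_iff)
    then have "prime q"
      by (simp add: in_prime_factors_iff)
    then show False
      using q \<open>prime p\<close> primes_dvd_imp_eq by blast
  qed
  then have "E (int m) False \<notin> extended p 0"
    using p by (simp add: E_in_extended in_prime_factors_iff)
  moreover have "E (int m) False \<in> M" if "M \<in> \<M>" for M
  proof -
    have "maximal_subgroup M G"
      using that \<M>(1) by blast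
    then show ?thesis
    proof (cases rule: maximal_subgroup_cases)
      case (2 q r)
      then have "q \<noteq> p"
        using no that by blast
      then show ?thesis
        using 2 q_dvd by (simp add: E_in_extended)
    qed simp
  qed
  moreover have "maximal_subgroup (extended p 0) G"
    using p by (simp add: maximal_extended in_prime_factors_iff)
  moreover have "E (int m) False \<in> frattini G"
    using calculation(2) by (simp flip: \<M>(2))
  ultimately show False
    by (simp add: frattini_def)
qed

lemma frattini_family_card:
  assumes \<M>: "finite \<M>" "\<forall>M\<in>\<M>. maximal_subgroup M G" "carrier G \<inter> \<Inter>\<M> = frattini G"
  shows "card (prime_factors n) + 1 \<le> card \<M>"
proof -
  have "\<forall>p\<in>prime_factors n. \<exists>r. extended p r \<in> \<M>"
    using frattini_family_meets_prime[OF \<M>(2,3)] by blast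
  from bchoice[OF this] obtain r
    where r: "\<And>p. p \<in> prime_factors n \<Longrightarrow> extended p (r p) \<in> \<M>"
    by blast
  define \<S> where "\<S> = (\<lambda>p. extended p (r p)) ` prime_factors n"
  \<comment> \<open>The integer residues are replaced by natural representatives to fit the Chinese
    remainder theorem over the naturals.\<close>
  have "\<exists>a. \<forall>p\<in>prime_factors n. [a = nat (r p mod int p)] (mod p)"
    by (rule chinese_remainder_nat) (auto simp: in_prime_factors_iff primes_coprime)
  then obtain a where a: "\<And>p. p \<in> prime_factors n \<Longrightarrow> [a = nat (r p mod int p)] (mod p)"
    by blast
  have "E (int a) True \<in> extended p (r p)" if p: "p \<in> prime_factors n" for p
  proof -
    have "p > 0"
      using p by (simp add: in_prime_factors_iff prime_gt_0_nat)
    then have "[int a = r p mod int p] (mod int p)"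
      using a[OF p] by (simp add: cong_int_iff[symmetric])
    then have "int p dvd int a - r p"
      by (simp add: cong_iff_dvd_diff[symmetric])
    then show ?thesis
      using p by (simp add: E_in_extended in_prime_factors_iff)
  qed
  then have "E (int a) True \<in> carrier G \<inter> \<Inter>\<S>"
    by (auto simp: \<S>_def)
  moreover have "E (int a) True \<notin> frattini G"
    using maximal_rotations by (auto simp: frattini_def)
  \<comment> \<open>Equality is impossible: x^a y lies in the intersection of \<open>\<S>\<close>,
    while the Frattini subgroup is contained in \<open>rotations\<close>.\<close>
  ultimately have "\<S> \<subset> \<M>"
    using r \<M>(3) by (auto simp: \<S>_def)
  then have "card \<S> < card \<M>"
    using \<M>(1) by (rule psubset_card_mono[rotated])
  then show ?thesis
    using card_image[OF inj_on_extended] by (simp add: \<S>_def)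
qed

lemma intersection_number_eq: "intersection_number G = card (prime_factors n) + 1"
  unfolding intersection_number_def
  by (rule Least_equality) (use frattini_witness frattini_family_card in blast)+

end

section \<open>Coordinates on the presented group\<close>

text \<open>
  Left multiplication of \<open>x\<^sup>a y\<^sup>s\<close> by a letter.  Its value on \<open>1\<close> tells the elements of the presented
  group apart.
\<close>

fun letter_act :: "nat \<Rightarrow> dic_gen letter \<Rightarrow> int \<times> bool \<Rightarrow> int \<times> bool" where
  "letter_act n (Gen X) (a, s) = (a + 1, s)"
| "letter_act n (Inv X) (a, s) = (a - 1, s)"
| "letter_act n (Gen Y) (a, s) = (if s then (int n - a, False) else (- a, True))"
| "letter_act n (Inv Y) (a, s) = (if s then (- a, False) else (int n - a, True))"

definition word_act :: "nat \<Rightarrow> dic_gen letter list \<Rightarrow> int \<times> bool \<Rightarrow> int \<times> bool" where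
  "word_act n u = foldr (letter_act n) u"

text \<open>Comparing unreduced integer exponents modulo \<open>2 * n\<close> keeps
  \<open>letter_act\<close> free of reductions.\<close>

definition coord_eq :: "nat \<Rightarrow> int \<times> bool \<Rightarrow> int \<times> bool \<Rightarrow> bool" where
  "coord_eq n z w \<longleftrightarrow> 2 * int n dvd fst z - fst w \<and> snd z = snd w"

lemma coord_eq_refl: "coord_eq n z z"
  by (simp add: coord_eq_def)

lemma coord_eq_sym: "coord_eq n z w \<Longrightarrow> coord_eq n w z"
  by (simp add: coord_eq_def dvd_diff_commute)

lemma coord_eq_trans: "coord_eq n z w \<Longrightarrow> coord_eq n w v \<Longrightarrow> coord_eq n z v"
  using dvd_add[of "2 * int n" "fst z - fst w" "fst w - fst v"] by (simp add: coord_eq_def)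

lemma word_act_append: "word_act n (u @ v) z = word_act n u (word_act n v z)"
  by (simp add: word_act_def)

lemma word_act_replicate_X: "word_act n (replicate m (Gen X)) (a, s) = (a + int m, s)"
  by (induction m) (auto simp: word_act_def)

lemma letter_act_cong:
  assumes "coord_eq n z w"
  shows "coord_eq n (letter_act n l z) (letter_act n l w)"
proof -
  obtain a s b where zw: "z = (a, s)" "w = (b, s)" "2 * int n dvd a - b"
    using assms by (cases z; cases w) (auto simp: coord_eq_def)
  then have "2 * int n dvd b - a"
    by (simp add: dvd_diff_commute)
  then show ?thesis
    using zw by (cases "(n, l, z)" rule: letter_act.cases) (auto simp: coord_eq_def)
qed

lemma word_act_cong: "coord_eq n z w \<Longrightarrow> coord_eq n (word_act n u z) (word_act n u w)"
  by (induction u) (auto simp: word_act_def letter_act_cong)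

text \<open>The action respects free cancellation and all three relations, so it is an invariant of
  the classes and can prove them distinct.\<close>

lemma word_act_pres_eq:
  assumes "pres_eq (dicyclic_rels n) u v"
  shows "coord_eq n (word_act n u z) (word_act n v z)"
  using assms
proof (induction arbitrary: z rule: pres_eq.induct)
  case (pres_append u u' v v')
  then show ?case
    by (metis coord_eq_trans word_act_append word_act_cong)
next
  case (pres_Gen_Inv g)
  then show ?case
    by (cases g; cases z) (auto simp: word_act_def coord_eq_def)
next
  case (pres_Inv_Gen g)
  then show ?case
    by (cases g; cases z) (auto simp: word_act_def coord_eq_def)
next
  case (pres_rel u v)
  obtain a s where z: "z = (a, s)"
    by (cases z)
  from pres_rel consider "u = replicate (2 * n) (Gen X)" "v = []"
    | "u = replicate n (Gen X)" "v = [Gen Y, Gen Y]"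
    | "u = [Inv X]" "v = [Inv Y, Gen X, Gen Y]"
    by (auto simp: dicyclic_rels_def)
  then show ?case
  proof cases
    case 1
    then show ?thesis
      by (simp add: z word_act_replicate_X coord_eq_def) (simp add: word_act_def)
  next
    case 2
    \<comment> \<open>On \<open>(a, True)\<close> the word y y gives \<open>a - n\<close> while x^n
      gives \<open>a + n\<close>; they agree only modulo \<open>2 * n\<close>.\<close>
    then show ?thesis
      by (simp add: z word_act_replicate_X coord_eq_def) (simp add: word_act_def)
  next
    case 3
    then show ?thesis
      by (auto simp: z word_act_def coord_eq_def)
  qed
qed (blast intro: coord_eq_refl coord_eq_sym coord_eq_trans)+

section \<open>The normal form x^a y^s and its multiplication law\<close>

abbreviation gen_class :: "nat \<Rightarrow> dic_gen \<Rightarrow> dic_gen letter list set" where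
  "gen_class n g \<equiv> pres_class (dicyclic_rels n) [Gen g]"

definition dic_elem :: "nat \<Rightarrow> int \<Rightarrow> bool \<Rightarrow> dic_gen letter list set" where
  "dic_elem n a s =
     gen_class n X [^]\<^bsub>dicyclic n\<^esub> a \<otimes>\<^bsub>dicyclic n\<^esub>
       (if s then gen_class n Y else \<one>\<^bsub>dicyclic n\<^esub>)"

lemma group_dicyclic: "group (dicyclic n)"
  by (simp add: dicyclic_def group_presented_group)

lemma dicyclic_mult:
  "pres_class (dicyclic_rels n) u \<otimes>\<^bsub>dicyclic n\<^esub> pres_class (dicyclic_rels n) v =
   pres_class (dicyclic_rels n) (u @ v)"
  by (simp add: dicyclic_def presented_group_mult)

lemma one_dicyclic: "\<one>\<^bsub>dicyclic n\<^esub> = pres_class (dicyclic_rels n) []"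
  by (simp add: dicyclic_def presented_group_def)

lemma carrier_dicyclic: "carrier (dicyclic n) = range (pres_class (dicyclic_rels n))"
  by (simp add: dicyclic_def presented_group_def)

lemma pres_class_in_dicyclic [simp]: "pres_class (dicyclic_rels n) u \<in> carrier (dicyclic n)"
  by (simp add: carrier_dicyclic)

lemma gen_class_X_pow:
  "gen_class n X [^]\<^bsub>dicyclic n\<^esub> m = pres_class (dicyclic_rels n) (replicate m (Gen X))"
  for m :: nat
  by (induction m)
     (simp_all add: one_dicyclic dicyclic_mult replicate_append_same)

lemma gen_class_inv:
  "inv\<^bsub>dicyclic n\<^esub> gen_class n g = pres_class (dicyclic_rels n) [Inv g]"
  by (rule group.inv_equality[OF group_dicyclic])
     (simp_all add: dicyclic_mult one_dicyclic pres_class_eq_iff pres_Inv_Gen)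

context
  fixes n :: nat
  assumes n_pos: "n > 0"
begin

interpretation group "dicyclic n"
  by (rule group_dicyclic)

private abbreviation (input) "Q \<equiv> dicyclic n"
private abbreviation (input) "x \<equiv> gen_class n X"
private abbreviation (input) "y \<equiv> gen_class n Y"

lemma x_pow_2n: "x [^]\<^bsub>Q\<^esub> (2 * n) = \<one>\<^bsub>Q\<^esub>"
  unfolding gen_class_X_pow one_dicyclic pres_class_eq_iff
  by (rule pres_rel) (simp add: dicyclic_rels_def)

lemma x_pow_n: "x [^]\<^bsub>Q\<^esub> n = y \<otimes>\<^bsub>Q\<^esub> y"
  unfolding gen_class_X_pow dicyclic_mult pres_class_eq_iff
  by (rule pres_rel) (simp add: dicyclic_rels_def)

lemma y_conj_x: "y \<otimes>\<^bsub>Q\<^esub> inv\<^bsub>Q\<^esub> x = x \<otimes>\<^bsub>Q\<^esub> y"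
proof -
  have "inv\<^bsub>Q\<^esub> x = inv\<^bsub>Q\<^esub> y \<otimes>\<^bsub>Q\<^esub> (x \<otimes>\<^bsub>Q\<^esub> y)"
    unfolding gen_class_inv dicyclic_mult pres_class_eq_iff
    by (rule pres_rel) (simp add: dicyclic_rels_def)
  then show ?thesis
    by (simp add: inv_solve_left)
qed

lemma y_x: "y \<otimes>\<^bsub>Q\<^esub> x = inv\<^bsub>Q\<^esub> x \<otimes>\<^bsub>Q\<^esub> y"
proof -
  have "y = x \<otimes>\<^bsub>Q\<^esub> y \<otimes>\<^bsub>Q\<^esub> x"
    using y_conj_x by (metis inv_closed inv_inv inv_solve_right m_closed pres_class_in_dicyclic)
  then show ?thesis
    by (simp add: inv_solve_left m_assoc)
qed

lemma y_x_nat_pow: "y \<otimes>\<^bsub>Q\<^esub> x [^]\<^bsub>Q\<^esub> m = inv\<^bsub>Q\<^esub> x [^]\<^bsub>Q\<^esub> m \<otimes>\<^bsub>Q\<^esub> y" for m :: nat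
proof (induction m)
  case (Suc m)
  have "y \<otimes>\<^bsub>Q\<^esub> x [^]\<^bsub>Q\<^esub> Suc m = (y \<otimes>\<^bsub>Q\<^esub> x [^]\<^bsub>Q\<^esub> m) \<otimes>\<^bsub>Q\<^esub> x"
    by (simp add: m_assoc)
  also have "\<dots> = inv\<^bsub>Q\<^esub> x [^]\<^bsub>Q\<^esub> m \<otimes>\<^bsub>Q\<^esub> (y \<otimes>\<^bsub>Q\<^esub> x)"
    by (simp add: Suc m_assoc)
  also have "\<dots> = inv\<^bsub>Q\<^esub> x [^]\<^bsub>Q\<^esub> Suc m \<otimes>\<^bsub>Q\<^esub> y"
    by (simp add: y_x m_assoc)
  finally show ?case .
qed simp

text \<open>Natural exponents are needed twice: to extend the inductive rule
  \<open>y_x_nat_pow\<close> to all integers, and to write a power of x as a word without inverse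
  letters.\<close>

lemma int_pow_mod_2n: "x [^]\<^bsub>Q\<^esub> a = x [^]\<^bsub>Q\<^esub> nat (a mod (2 * int n))" for a :: int
proof -
  have "x [^]\<^bsub>Q\<^esub> (2 * int n * (a div (2 * int n))) = \<one>\<^bsub>Q\<^esub>"
    using x_pow_2n int_pow_int[of Q x "2 * n"] by (simp add: int_pow_pow[symmetric])
  then have "x [^]\<^bsub>Q\<^esub> (2 * int n * (a div (2 * int n)) + a mod (2 * int n)) =
      x [^]\<^bsub>Q\<^esub> (a mod (2 * int n))"
    by (simp only: int_pow_mult[OF pres_class_in_dicyclic]) simp
  also have "\<dots> = x [^]\<^bsub>Q\<^esub> nat (a mod (2 * int n))"
    using n_pos int_pow_int[of Q x "nat (a mod (2 * int n))"] by simp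
  finally show ?thesis
    by simp
qed

lemma y_x_pow: "y \<otimes>\<^bsub>Q\<^esub> x [^]\<^bsub>Q\<^esub> a = x [^]\<^bsub>Q\<^esub> (- a) \<otimes>\<^bsub>Q\<^esub> y" for a :: int
proof -
  define m where "m = nat (a mod (2 * int n))"
  have m: "int m = a mod (2 * int n)"
    using n_pos by (simp add: m_def)
  have "x [^]\<^bsub>Q\<^esub> (- int m) = x [^]\<^bsub>Q\<^esub> (- a)"
    using int_pow_mod_2n[of "- int m"] int_pow_mod_2n[of "- a"] by (metis m mod_minus_eq)
  moreover have "inv\<^bsub>Q\<^esub> x [^]\<^bsub>Q\<^esub> m = x [^]\<^bsub>Q\<^esub> (- int m)"
    by (simp add: int_pow_neg int_pow_int nat_pow_inv)
  ultimately show ?thesis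
    using y_x_nat_pow[of m] int_pow_mod_2n[of a] by (simp add: m_def)
qed

text \<open>Moving y past x^b negates \<open>b\<close>; two letters y merge into x^n, which accounts
  for the summand \<open>n\<close>.\<close>

lemma dic_elem_mult:
  "dic_elem n a s \<otimes>\<^bsub>Q\<^esub> dic_elem n b t =
   dic_elem n (a + (if s then - b else b) + (if s \<and> t then int n else 0)) (s \<noteq> t)"
proof -
  have yxy: "y \<otimes>\<^bsub>Q\<^esub> (x [^]\<^bsub>Q\<^esub> b \<otimes>\<^bsub>Q\<^esub> z) = x [^]\<^bsub>Q\<^esub> (- b) \<otimes>\<^bsub>Q\<^esub> (y \<otimes>\<^bsub>Q\<^esub> z)"
    if "z \<in> carrier Q" for z
    using that y_x_pow[of b] by (simp add: m_assoc[symmetric])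
  have yy: "y \<otimes>\<^bsub>Q\<^esub> y = x [^]\<^bsub>Q\<^esub> int n"
    using x_pow_n by (simp add: int_pow_int)
  show ?thesis
    by (cases s; cases t)
       (simp_all add: dic_elem_def m_assoc yxy yy y_x_pow int_pow_mult int_pow_diff int_pow_neg)
qed

lemma one_dic_elem: "\<one>\<^bsub>Q\<^esub> = dic_elem n 0 False"
  by (simp add: dic_elem_def)

lemma dic_elem_closed: "dic_elem n a s \<in> carrier Q"
  by (simp add: dic_elem_def)

lemma dic_elem_word:
  "dic_elem n a s = pres_class (dicyclic_rels n)
     (replicate (nat (a mod (2 * int n))) (Gen X) @ (if s then [Gen Y] else []))"
  by (simp add: dic_elem_def int_pow_mod_2n gen_class_X_pow dicyclic_mult one_dicyclic)

text \<open>The forward direction shows that the presentation collapses no further: the action of a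
  normal-form word on \<open>(0, False)\<close>, the coordinates of 1, recovers its exponent modulo
  \<open>2 * n\<close> and its y-part.\<close>

lemma dic_elem_eq_iff: "dic_elem n a s = dic_elem n b t \<longleftrightarrow> 2 * int n dvd a - b \<and> s = t"
proof
  assume "2 * int n dvd a - b \<and> s = t"
  then show "dic_elem n a s = dic_elem n b t"
    by (metis dic_elem_word mod_eq_dvd_iff)
next
  let ?w = "\<lambda>a s. replicate (nat (a mod (2 * int n))) (Gen X) @ (if s then [Gen Y] else [])"
  assume "dic_elem n a s = dic_elem n b t"
  then have "coord_eq n (word_act n (?w a s) (0, False)) (word_act n (?w b t) (0, False))"
    unfolding dic_elem_word pres_class_eq_iff by (rule word_act_pres_eq)
  moreover have "word_act n (?w a s) (0, False) = (a mod (2 * int n), s)" for a s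
  proof -
    have "word_act n (if s then [Gen Y] else []) (0, False) = (0, s)"
      by (simp add: word_act_def)
    then show ?thesis
      using n_pos by (simp add: word_act_append word_act_replicate_X)
  qed
  ultimately show "2 * int n dvd a - b \<and> s = t"
    by (simp add: coord_eq_def mod_eq_dvd_iff[symmetric])
qed

text \<open>Induction on words: each letter is itself of the form \<open>dic_elem\<close>, and these
  elements are closed under multiplication.\<close>

lemma carrier_dicyclic_elem: "carrier Q = {dic_elem n a s |a s. True}"
proof -
  have "\<exists>a s. pres_class (dicyclic_rels n) u = dic_elem n a s" for u
  proof (induction u)
    case Nil
    show ?case
      by (metis one_dicyclic one_dic_elem)
  next
    case (Cons l u)
    have gens: "gen_class n X = dic_elem n 1 False" "gen_class n Y = dic_elem n 0 True"
      by (simp_all add: dic_elem_def)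
    \<comment> \<open>The inverse of y is x^n y, since y^2 = x^n and x^(2n) = 1.\<close>
    have "inv\<^bsub>Q\<^esub> gen_class n X = dic_elem n (- 1) False"
      "inv\<^bsub>Q\<^esub> gen_class n Y = dic_elem n (int n) True"
      by (rule inv_equality;
          simp add: gens dic_elem_mult dic_elem_eq_iff one_dic_elem dic_elem_closed)+
    then have "\<exists>b t. pres_class (dicyclic_rels n) [l] = dic_elem n b t"
      unfolding gen_class_inv using gens by (cases l rule: letter.exhaust; metis dic_gen.exhaust)
    then obtain b t where "pres_class (dicyclic_rels n) [l] = dic_elem n b t"
      by blast
    moreover obtain a s where "pres_class (dicyclic_rels n) u = dic_elem n a s"
      using Cons by blast
    ultimately have "pres_class (dicyclic_rels n) (l # u) = dic_elem n b t \<otimes>\<^bsub>Q\<^esub> dic_elem n a s"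
      using dicyclic_mult[of n "[l]" u] by simp
    then show ?case
      unfolding dic_elem_mult by blast
  qed
  then show ?thesis
    using dic_elem_closed by (auto simp: carrier_dicyclic)
qed

lemma dicyclic_coordinates: "dicyclic_coordinates Q n (dic_elem n)"
  by unfold_locales (use n_pos carrier_dicyclic_elem dic_elem_eq_iff dic_elem_mult in auto)

end

section \<open>From the given factorization to the number of prime factors\<close>

lemma prime_factors_prod_powers:
  fixes p e :: "'b \<Rightarrow> nat"
  assumes "finite I" "\<And>i. i \<in> I \<Longrightarrow> prime (p i)" "\<And>i. i \<in> I \<Longrightarrow> e i > 0"
  shows "prime_factors (\<Prod>i\<in>I. p i ^ e i) = p ` I"
proof -
  have nz: "(\<Prod>i\<in>I. p i ^ e i) \<noteq> 0"
    using assms by (auto simp: prime_gt_0_nat)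
  show ?thesis
  proof (intro equalityI subsetI)
    fix q assume q: "q \<in> prime_factors (\<Prod>i\<in>I. p i ^ e i)"
    then have "prime q" "q dvd (\<Prod>i\<in>I. p i ^ e i)"
      by auto
    then obtain i where i: "i \<in> I" "q dvd p i ^ e i"
      using assms(1) by (auto simp: prime_dvd_prod_iff)
    then have "q = p i"
      using \<open>prime q\<close> assms(2) by (metis prime_dvd_power primes_dvd_imp_eq)
    then show "q \<in> p ` I"
      using i by blast
  next
    fix q assume "q \<in> p ` I"
    then obtain i where i: "i \<in> I" "q = p i"
      by blast
    have "q dvd p i ^ e i"
      using i assms(3) by (simp add: dvd_power)
    also have "\<dots> dvd (\<Prod>i\<in>I. p i ^ e i)"
      using assms(1) i(1) by (intro dvd_prodI) auto
    finally show "q \<in> prime_factors (\<Prod>i\<in>I. p i ^ e i)"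
      using i assms(2) nz by (simp add: in_prime_factors_iff)
  qed
qed

theorem proposition4p2:
  fixes n k :: nat and p e :: "nat \<Rightarrow> nat"
  assumes "n \<ge> 2"
    and "\<And>i. i \<in> {1..k} \<Longrightarrow> prime (p i)"
    and "inj_on p {1..k}"
    and "\<And>i. i \<in> {1..k} \<Longrightarrow> e i > 0"
    and "n = (\<Prod>i=1..k. p i ^ e i)"
  shows "intersection_number (dicyclic n) = k + 1"
proof -
  have "prime_factors n = p ` {1..k}"
    unfolding assms(5) by (rule prime_factors_prod_powers) (use assms in auto)
  then have "card (prime_factors n) = k"
    using assms(3) by (simp add: card_image)
  moreover have "dicyclic_coordinates (dicyclic n) n (dic_elem n)"
    using assms(1) by (intro dicyclic_coordinates) simp
  ultimately show ?thesis
    by (simp add: dicyclic_coordinates.intersection_number_eq)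
qed

end
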